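(* Let $n \ge 2$ and $N = n \cdot n!$. The string $\coprod(n) = a_0 a_1 \cdots a_{N-1}$ is a multiversal cycle for the $(n-1)$-permutations of $\{1,\ldots,n\}$; that is, regarding it as circular (indices modulo $N$), for every $m \in \{0,1,\ldots,n-1\}$, \[ \{ a_{m+in}\, a_{m+in+1} \cdots a_{m+in+n-2} \mid i = 1,2,\ldots,n! \} = \mathbb{S}_{n-1,n}, \] the set of all $(n-1)$-permutations of $\{1,\ldots,n\}$ (sequences of $n-1$ distinct elements of $\{1,\ldots,n\}$).
   Context: Permutations are written in one-line notation, and for $1 \le k \le n$ the operation $\sigma_k = (1\ 2\ \cdots\ k)$ acts on positions: $\sigma_k(x_1 x_2 \cdots x_n) = x_2 \cdots x_k\, x_1\, x_{k+1}\cdots x_n$. The circular list $\Pi(n) = \Pi(n)_0, \Pi(n)_1, \ldots, \Pi(n)_{n!-1}$ of permutations of $\{1,\ldots,n\}$ is defined recursively: $\Pi(1) = 1$; $\Pi(2) = 21, 12$; $\Pi(3) = 321, 213, 132, 312, 123, 231$; and for $n \ge 4$, for each $j = 0, \ldots, (n-1)!-1$, with $\pi = \Pi(n-1)_j$, set $\Pi(n)_{jn} = n\pi$ (the symbol $n$ followed by $\pi$) and let $\Pi(n)_{jn+1}, \ldots, \Pi(n)_{jn+n-1}$ be, in order, $\sigma_n(n\pi),\ \sigma_n^2(n\pi),\ \sigma_{n-1}(\sigma_n^2(n\pi)),\ \ldots,\ \sigma_{n-1}^{n-3}(\sigma_n^2(n\pi))$. The flattening $\coprod(n)$ is the string of length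 $n\cdot n!$ obtained by concatenating $\Pi(n)_0, \ldots, \Pi(n)_{n!-1}$, each written as a word of length $n$. *)

theory Defs
  imports Main
begin

text \<open>Permutations of \<open>{1..n}\<close> are lists of naturals (one-line notation), and \<open>sigma k\<close>
  rotates the prefix of length \<open>k\<close> by one place to the left.\<close>

definition sigma :: "nat \<Rightarrow> 'a list \<Rightarrow> 'a list" where
  "sigma k xs = rotate1 (take k xs) @ drop k xs"

text \<open>The \<open>n\<close> consecutive entries contributed to the list for \<open>n\<close> by one entry \<open>p\<close> of the list
  for \<open>n - 1\<close>. The range of exponents of \<open>sigma (n - 1)\<close> is \<open>0, \<dots>, n - 3\<close>.\<close>

definition perm_block :: "nat \<Rightarrow> nat list \<Rightarrow> nat list list" where
  "perm_block n p =
     [n # p, sigma n (n # p)] @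
     map (\<lambda>k. (sigma (n - 1) ^^ k) ((sigma n ^^ 2) (n # p))) [0..<n - 2]"

text \<open>The circular list \<open>\<Pi>(n)\<close>. As each block has length \<open>n\<close>, concatenating the blocks puts the
  block of the \<open>j\<close>-th entry at positions \<open>j * n, \<dots>, j * n + n - 1\<close>. The value at \<open>0\<close> is a dummy.\<close>

fun perm_list :: "nat \<Rightarrow> nat list list" where
  "perm_list 0 = []"
| "perm_list (Suc 0) = [[1]]"
| "perm_list (Suc (Suc 0)) = [[2, 1], [1, 2]]"
| "perm_list (Suc (Suc (Suc 0))) =
     [[3, 2, 1], [2, 1, 3], [1, 3, 2], [3, 1, 2], [1, 2, 3], [2, 3, 1]]"
| "perm_list (Suc (Suc (Suc (Suc m)))) =
     concat (map (perm_block (Suc (Suc (Suc (Suc m))))) (perm_list (Suc (Suc (Suc m)))))"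

definition flattening :: "nat \<Rightarrow> nat list" where
  "flattening n = concat (perm_list n)"

definition k_perms :: "nat \<Rightarrow> nat \<Rightarrow> nat list set" where
  "k_perms k n = {xs. length xs = k \<and> distinct xs \<and> set xs \<subseteq> {1..n}}"

definition circ_substring :: "'a list \<Rightarrow> nat \<Rightarrow> nat \<Rightarrow> 'a list" where
  "circ_substring a s l = map (\<lambda>j. a ! ((s + j) mod length a)) [0..<l]"

text \<open>Multiversal cycles for the \<open>(n - 1)\<close>-permutations of \<open>{1..n}\<close>: for every offset \<open>m\<close>, the
  substrings of length \<open>n - 1\<close> starting at the positions congruent to \<open>m\<close> modulo \<open>n\<close> are
  all these permutations.\<close>

definition multiversal_cycle :: "nat \<Rightarrow> nat list \<Rightarrow> bool" where
  "multiversal_cycle n a \<longleftrightarrow>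
     length a = n * fact n \<and>
     (\<forall>m\<in>{0..n - 1}.
        {circ_substring a (m + i * n) (n - 1) | i. i \<in> {1..fact n}} = k_perms (n - 1) n)"

end

theory Submission
  imports Defs
begin

text \<open>Cyclically consecutive entries of \<open>perm_list n\<close> differ by \<open>sigma n\<close> or \<open>sigma (n - 1)\<close>.
  Both move the entries at positions \<open>2, \<dots>, n - 1\<close> one place to the left, so for \<open>m > 0\<close> the
  window at offset \<open>m\<close> of the entry \<open>x\<close> is \<open>x\<^sub>m\<^sub>+\<^sub>1 \<dots> x\<^sub>n x\<^sub>2 \<dots> x\<^sub>m\<close>, whichever
  of the two occurs; it misses exactly \<open>x\<^sub>1\<close>. For \<open>m = 0\<close> the window is \<open>x\<close> without its last
  entry. As every permutation occurs in the list, every \<open>(n - 1)\<close>-permutation occurs as a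
  window.\<close>

section \<open>Permutations and the blocks they generate\<close>

definition perms :: "nat \<Rightarrow> nat list set" where
  "perms n = {xs. distinct xs \<and> set xs = {1..n}}"

lemma length_perms: "xs \<in> perms n \<Longrightarrow> length xs = n"
  using distinct_card[of xs] by (simp add: perms_def)

lemma sigma_length: "length xs = k \<Longrightarrow> sigma k xs = rotate1 xs"
  by (simp add: sigma_def)

lemma sigma_append: "length xs = k \<Longrightarrow> sigma k (xs @ ys) = rotate1 xs @ ys"
  by (simp add: sigma_def)

lemma sigma_funpow_append:
  "length xs = k \<Longrightarrow> (sigma k ^^ j) (xs @ ys) = rotate j xs @ ys"
  by (induction j) (simp_all add: sigma_append)

text \<open>Two full rotations bring \<open>c\<close> to the last place, where
  \<open>sigma (n - 1)\<close> never touches it. So the remaining entries are rotations of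
  \<open>q @ [n]\<close> in front of a fixed \<open>c\<close>.\<close>

lemma perm_block_Cons:
  assumes "length q = n - 2" "n \<ge> 2"
  shows "perm_block n (c # q) =
    [n # c # q, c # q @ [n]] @ map (\<lambda>k. rotate k (q @ [n]) @ [c]) [0..<n - 2]"
proof -
  have "(sigma n ^^ 2) (n # c # q) = (q @ [n]) @ [c]"
    using assms by (simp add: numeral_2_eq_2 sigma_length)
  moreover have "length (q @ [n]) = n - 1"
    using assms by simp
  ultimately show ?thesis
    using assms by (simp only: perm_block_def sigma_funpow_append) (simp add: sigma_length)
qed

lemma length_perm_block: "n \<ge> 2 \<Longrightarrow> length (perm_block n p) = n"
  by (simp add: perm_block_def)

lemma perm_block_perms:
  assumes "p \<in> perms (n - 1)" "n \<ge> 2" "x \<in> set (perm_block n p)"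
  shows "x \<in> perms n"
proof -
  have *: "distinct p" "set p = {1..n - 1}" "length p = n - 1"
    using assms(1) length_perms by (auto simp: perms_def)
  then obtain c q where p: "p = c # q"
    using assms(2) by (cases p) auto
  have "insert n {1..n - 1} = {1..n}"
    using assms(2) by auto
  moreover have "n \<notin> {1..n - 1}"
    using assms(2) by auto
  ultimately have n: "n \<notin> set p" "insert n (set p) = {1..n}"
    using *(2) by simp_all
  have "length q = n - 2"
    using * p by simp
  then consider "x = n # c # q" | "x = c # q @ [n]" | k where "x = rotate k (q @ [n]) @ [c]"
    using assms(3) unfolding p perm_block_Cons[OF \<open>length q = n - 2\<close> assms(2)] by auto
  then show ?thesis
    using n *(1) p by cases (auto simp: perms_def)
qed

text \<open>The place of \<open>n\<close> in \<open>x\<close> determines \<open>p\<close>. If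
  \<open>n\<close> is last or first, deleting it gives \<open>p\<close>, and \<open>x\<close> is the
  second or first entry of the block. Otherwise \<open>x\<close> has the form
  \<open>a @ n # b' @ [c]\<close>; its last symbol \<open>c\<close> must lead \<open>p\<close>, and
  reading cyclically after \<open>n\<close> gives \<open>b' @ a\<close>.\<close>

lemma perms_in_perm_block:
  assumes "x \<in> perms n" "n \<ge> 2"
  obtains p where "p \<in> perms (n - 1)" "x \<in> set (perm_block n p)"
proof -
  have x: "distinct x" "set x = {1..n}" "length x = n"
    using assms(1) length_perms by (auto simp: perms_def)
  have "n \<in> set x"
    using x assms(2) by auto
  then obtain a b where ab: "x = a @ n # b"
    by (auto simp: in_set_conv_decomp)
  have "set a \<union> set b = set x - {n}"
    using ab x(1) by auto
  also have "\<dots> = {1..n - 1}"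
    unfolding x(2) by auto
  finally have set_ab: "set a \<union> set b = {1..n - 1}" .
  show ?thesis
  proof (cases b rule: rev_cases)
    case Nil
    have "a \<in> perms (n - 1)"
      using Nil set_ab ab x(1) by (auto simp: perms_def)
    moreover have "x \<in> set (perm_block n a)"
      using Nil ab x(3) by (simp add: perm_block_def sigma_length)
    ultimately show ?thesis by (rule that)
  next
    case (snoc b' c)
    show ?thesis
    proof (cases "a = []")
      case True
      have "b \<in> perms (n - 1)"
        using True set_ab ab x(1) by (auto simp: perms_def)
      moreover have "x \<in> set (perm_block n b)"
        using True ab by (simp add: perm_block_def)
      ultimately show ?thesis by (rule that)
    next
      case False
      have "c # b' @ a \<in> perms (n - 1)"
        using snoc set_ab ab x(1) by (auto simp: perms_def)
      moreover have "x \<in> set (perm_block n (c # b' @ a))"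
      proof -
        have len: "length (b' @ a) = n - 2"
          using x(3) ab snoc by simp
        \<comment> \<open>The exponent \<open>length b'\<close> is in range because \<open>a\<close>
          is nonempty; the excluded value \<open>n - 2\<close> would put \<open>n\<close> in
          front.\<close>
        have "length b' < n - 2"
          using len False by (cases a) auto
        moreover have "x = rotate (length b') ((b' @ a) @ [n]) @ [c]"
          using ab snoc by (simp add: rotate_append)
        ultimately show ?thesis
          unfolding perm_block_Cons[OF len assms(2)] by auto
      qed
      ultimately show ?thesis by (rule that)
    qed
  qed
qed

section \<open>Steps inside a block and from one block to the next\<close>

definition sigma_step :: "nat \<Rightarrow> 'a list \<Rightarrow> 'a list \<Rightarrow> bool" where
  "sigma_step n x y \<longleftrightarrow> y = sigma n x \<or> y = sigma (n - 1) x"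

text \<open>The bound stops just before \<open>t = n - 2\<close>, where the two rotations part:
  \<open>sigma n\<close> puts the last symbol of \<open>x\<close> there,
  \<open>sigma (n - 1)\<close> the first.\<close>

lemma sigma_step_nth:
  assumes "sigma_step n x y" "length x = n" "t + 2 < n"
  shows "y ! t = x ! Suc t"
  using assms
  by (auto simp: sigma_step_def sigma_def nth_append nth_rotate1)

lemma successively_perm_block:
  assumes "length p = n - 1" "n \<ge> 3"
  shows "successively (sigma_step n) (perm_block n p)"
proof -
  obtain c q where p: "p = c # q"
    using assms by (cases p) auto
  have len: "length q = n - 2"
    using assms p by simp
  let ?f = "\<lambda>k. rotate k (q @ [n]) @ [c]"
  have step: "sigma_step n (?f k) (?f (Suc k))" for k
    using len assms(2) by (simp add: sigma_step_def sigma_append)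
  have "successively (sigma_step n) (map ?f [0..<n - 2])"
    using step by (auto simp: successively_conv_nth simp del: rotate_Suc)
  moreover have "hd (map ?f [0..<n - 2]) = ?f 0"
    using assms(2) by (simp add: hd_map)
  moreover have "sigma_step n (n # c # q) (c # q @ [n])" "sigma_step n (c # q @ [n]) (?f 0)"
    using len assms(2) by (simp_all add: sigma_step_def sigma_length)
  ultimately show ?thesis
    using len assms(2) by (simp add: p perm_block_Cons successively_append_iff successively_Cons)
qed

text \<open>For \<open>p = c # q' @ [d]\<close> the block ends with
  \<open>[d, n] @ q' @ [c]\<close>. Its two rotations are \<open>n\<close> followed by the two
  rotations of \<open>p\<close>, with long and short exchanged: \<open>sigma (n - 1)\<close> matches
  the full rotation of \<open>p\<close>, and \<open>sigma n\<close> the one that fixes the last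
  symbol \<open>d\<close>.\<close>

lemma sigma_step_perm_block:
  assumes "length p = n - 1" "n \<ge> 3" "sigma_step (n - 1) p p'"
  shows "sigma_step n (last (perm_block n p)) (hd (perm_block n p'))"
proof -
  obtain c q where p: "p = c # q"
    using assms by (cases p) auto
  obtain q' d where q: "q = q' @ [d]"
    using assms p by (cases q rule: rev_cases) auto
  have len: "length q' = n - 3" "length q = n - 2"
    using assms p q by simp_all
  \<comment> \<open>The last exponent \<open>n - 3\<close> equals the length of \<open>q'\<close>,
    so this rotation just swaps \<open>q'\<close> with \<open>[d, n]\<close>.\<close>
  have "last (perm_block n p) = rotate (n - 3) (q @ [n]) @ [c]"
    using assms(2) by (simp add: p perm_block_Cons len last_map numeral_3_eq_3)
  also have "\<dots> = rotate (length q') (q' @ [d, n]) @ [c]"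
    by (simp add: len q)
  also have "\<dots> = [d, n] @ q' @ [c]"
    by (simp only: rotate_append) simp
  finally have last: "last (perm_block n p) = [d, n] @ q' @ [c]" .
  have hd: "hd (perm_block n p') = n # p'"
    by (simp add: perm_block_def)
  have "sigma (n - 1) ([d, n] @ q' @ [c]) = n # q' @ [d, c]"
    using sigma_append[of "[d, n] @ q'" "n - 1" "[c]"] len assms(2) by simp
  moreover have "sigma n ([d, n] @ q' @ [c]) = n # q' @ [c, d]"
    using len assms(2) by (simp add: sigma_length)
  moreover have "sigma (n - 1) p = q' @ [d, c]"
    using assms(1) by (simp add: p q sigma_length)
  moreover have "sigma (n - 1 - 1) p = q' @ [c, d]"
    using sigma_append[of "c # q'" "n - 1 - 1" "[d]"] len assms(2) by (simp add: p q)
  ultimately show ?thesis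
    using assms(3) unfolding last hd by (auto simp: sigma_step_def)
qed

section \<open>Recursion, length and contents of the list\<close>

lemma perm_list_rec:
  assumes "n \<ge> 3"
  shows "perm_list n = concat (map (perm_block n) (perm_list (n - 1)))"
proof (cases "n = 3")
  case True
  \<comment> \<open>The explicit list for 3 is what the block construction yields from
    \<open>[2, 1]\<close> and \<open>[1, 2]\<close>; each block then has a single entry in its
    rotating part.\<close>
  then show ?thesis
    by (simp add: numeral_3_eq_3 numeral_2_eq_2 perm_block_def sigma_def)
next
  case False
  then have "n = Suc (Suc (Suc (Suc (n - 4))))"
    using assms by simp
  then show ?thesis
    using perm_list.simps(5)[of "n - 4"] by (metis diff_Suc_1)
qed

lemma perms_2: "perms 2 = {[2, 1], [1, 2]}"
proof -
  have "xs = [2, 1] \<or> xs = [1, 2]" if "xs \<in> perms 2" for xs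
  proof -
    have "length xs = 2"
      using that by (rule length_perms)
    then obtain a b where "xs = [a, b]"
      by (auto simp: numeral_2_eq_2 length_Suc_conv)
    moreover have "{1..2} = {1, 2 :: nat}"
      by auto
    ultimately show ?thesis
      using that by (auto simp: perms_def doubleton_eq_iff)
  qed
  then show ?thesis
    by (auto simp: perms_def)
qed

lemma length_perm_list: "n \<ge> 2 \<Longrightarrow> length (perm_list n) = fact n"
proof (induction n rule: nat_induct_at_least)
  case base
  then show ?case by (simp add: numeral_2_eq_2)
next
  case (Suc n)
  have "length (perm_list (Suc n)) = sum_list (map (\<lambda>p. Suc n) (perm_list n))"
    using Suc.hyps by (simp add: perm_list_rec length_concat length_perm_block comp_def
        del: perm_list.simps)
  also have "\<dots> = fact (Suc n)"
    by (simp add: sum_list_triv Suc.IH)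
  finally show ?case .
qed

lemma set_perm_list: "n \<ge> 2 \<Longrightarrow> set (perm_list n) = perms n"
proof (induction n rule: nat_induct_at_least)
  case base
  then show ?case
    unfolding perms_2 by (simp add: numeral_2_eq_2)
next
  case (Suc n)
  have "set (perm_list (Suc n)) = (\<Union>p\<in>perms n. set (perm_block (Suc n) p))"
    using Suc by (simp add: perm_list_rec del: perm_list.simps)
  also have "\<dots> = perms (Suc n)"
  proof
    show "(\<Union>p\<in>perms n. set (perm_block (Suc n) p)) \<subseteq> perms (Suc n)"
      using perm_block_perms[of _ "Suc n"] Suc.hyps by auto
    show "perms (Suc n) \<subseteq> (\<Union>p\<in>perms n. set (perm_block (Suc n) p))"
    proof
      fix x assume "x \<in> perms (Suc n)"
      then obtain p where "p \<in> perms (Suc n - 1)" "x \<in> set (perm_block (Suc n) p)"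
        by (rule perms_in_perm_block) (use Suc.hyps in simp)
      then show "x \<in> (\<Union>p\<in>perms n. set (perm_block (Suc n) p))"
        by auto
    qed
  qed
  finally show ?case .
qed

section \<open>The circular chain of steps\<close>

lemma successively_concat_map:
  assumes "successively Q ps" "\<And>p. p \<in> set ps \<Longrightarrow> f p \<noteq> [] \<and> successively R (f p)"
    "\<And>p q. p \<in> set ps \<Longrightarrow> Q p q \<Longrightarrow> R (last (f p)) (hd (f q))"
  shows "successively R (concat (map f ps))"
  using assms
proof (induction ps)
  case Nil
  then show ?case by simp
next
  case (Cons p ps)
  have IH: "successively R (concat (map f ps))"
    using Cons by (auto simp: successively_Cons)
  show ?case
  proof (cases ps)
    case Nil
    then show ?thesis using Cons.prems by simp
  next
    case (Cons q qs)
    then have "hd (concat (map f ps)) = hd (f q)"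
      using Cons.prems(2)[of q] by simp
    then show ?thesis
      using IH Cons Cons.prems by (auto simp: successively_append_iff)
  qed
qed

text \<open>The wrap-around step is carried through the induction: the junction from the last block
  back to the first comes from the wrap-around step of the shorter list, just as inner junctions
  come from its inner steps.\<close>

lemma sigma_step_perm_list:
  assumes "n \<ge> 2"
  shows "successively (sigma_step n) (perm_list n) \<and>
    sigma_step n (last (perm_list n)) (hd (perm_list n))"
  using assms
proof (induction n rule: nat_induct_at_least)
  case base
  then show ?case
    by (simp add: numeral_2_eq_2 sigma_step_def sigma_def)
next
  case (Suc n)
  let ?L = "perm_list n" and ?f = "perm_block (Suc n)"
  have len: "length p = n" if "p \<in> set ?L" for p
    using that Suc.hyps by (simp add: set_perm_list length_perms)
  have ne: "?f p \<noteq> []" for p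
    by (simp add: perm_block_def)
  have L: "?L \<noteq> []"
    using length_perm_list[OF Suc.hyps] by auto
  have rec: "perm_list (Suc n) = concat (map ?f ?L)"
    using Suc.hyps by (simp add: perm_list_rec del: perm_list.simps)
  have "successively (sigma_step (Suc n)) (concat (map ?f ?L))"
    using Suc.IH Suc.hyps
    by (intro successively_concat_map[of "sigma_step n"])
      (auto simp: len ne successively_perm_block sigma_step_perm_block)
  moreover have "hd (concat (map ?f ?L)) = hd (?f (hd ?L))"
    using L ne by (cases ?L) auto
  moreover have "last (concat (map ?f ?L)) = last (?f (last ?L))"
    using L ne by (cases ?L rule: rev_cases) auto
  moreover have "sigma_step (Suc n) (last (?f (last ?L))) (hd (?f (hd ?L)))"
    using Suc L by (intro sigma_step_perm_block) (auto simp: len)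
  ultimately show ?case
    unfolding rec by simp
qed

section \<open>Windows of the flattening as \<open>(n - 1)\<close>-permutations\<close>

lemma nth_concat_const:
  assumes "\<forall>xs\<in>set xss. length xs = n" "i < length xss" "r < n"
  shows "concat xss ! (i * n + r) = xss ! i ! r"
  using assms
proof (induction xss arbitrary: i)
  case Nil
  then show ?case by simp
next
  case (Cons xs xss)
  then show ?case
    by (cases i) (auto simp: nth_append)
qed

lemma length_concat_const:
  "\<forall>xs\<in>set xss. length xs = n \<Longrightarrow> length (concat xss) = n * length xss"
  by (induction xss) auto

text \<open>The symbols taken from the next entry are expressed through \<open>x\<close> alone, so
  the kind of step is irrelevant. The case \<open>m = 0\<close> is separate because the general
  formula would return all of \<open>x\<close>.\<close>

definition window :: "nat \<Rightarrow> 'a list \<Rightarrow> 'a list" where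
  "window m x = (if m = 0 then butlast x else drop m x @ take (m - 1) (tl x))"

lemma circ_substring_flattening:
  assumes "n \<ge> 2" "m < n"
  shows "circ_substring (flattening n) (m + i * n) (n - 1) =
    window m (perm_list n ! (i mod fact n))"
proof -
  let ?L = "perm_list n" and ?F = "fact n :: nat"
  define x where "x = ?L ! (i mod ?F)"
  define y where "y = ?L ! (Suc i mod ?F)"
  have len: "length ?L = ?F"
    using assms(1) by (rule length_perm_list)
  have const: "\<forall>xs\<in>set ?L. length xs = n"
    using assms(1) by (simp add: set_perm_list length_perms)
  have nth: "concat ?L ! ((k * n + r) mod (n * ?F)) = ?L ! (k mod ?F) ! r" if "r < n" for k r
  proof -
    \<comment> \<open>The modulus is a multiple of \<open>n\<close>, so reduction changes the entry
      number \<open>k\<close> and leaves the offset \<open>r\<close> alone.\<close>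
    have "(k * n + r) mod (n * ?F) = k mod ?F * n + r"
      using that by (simp add: mod_mult2_eq)
    then show ?thesis
      using that const by (simp add: nth_concat_const len)
  qed
  have lx: "length x = n"
    using const by (simp add: x_def len)
  have "sigma_step n x y"
  proof (cases "Suc (i mod ?F) < ?F")
    case True
    then show ?thesis
      using sigma_step_perm_list[OF assms(1)]
      by (auto simp: successively_conv_nth x_def y_def len mod_Suc)
  next
    \<comment> \<open>Here \<open>x\<close> is the last entry of the list and \<open>y\<close> the
      first.\<close>
    case False
    moreover have "i mod ?F < ?F"
      by simp
    ultimately have "Suc (i mod ?F) = ?F"
      by linarith
    then have "i mod ?F = length ?L - 1" "Suc i mod ?F = 0"
      by (auto simp: mod_Suc len)
    moreover have "?L \<noteq> []"
      using len by auto
    ultimately show ?thesis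
      using sigma_step_perm_list[OF assms(1)]
      by (simp add: x_def y_def last_conv_nth hd_conv_nth)
  qed
  then have y: "y ! t = x ! Suc t" if "t + 2 < n" for t
    using lx that by (rule sigma_step_nth)
  have "circ_substring (flattening n) (m + i * n) (n - 1) ! j = window m x ! j"
    if j: "j < n - 1" for j
  proof -
    have *: "circ_substring (flattening n) (m + i * n) (n - 1) ! j =
      concat ?L ! ((i * n + (m + j)) mod (n * ?F))"
      using j by (simp add: circ_substring_def flattening_def length_concat_const[OF const] len
          algebra_simps)
    show ?thesis
    proof (cases "m + j < n")
      case True
      then show ?thesis
        using j lx unfolding * nth[OF True] x_def[symmetric]
        by (auto simp: window_def nth_append nth_butlast)
    next
      case False
      then have "i * n + (m + j) = Suc i * n + (m + j - n)"
        by simp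
      moreover have "m + j - n < n"
        using j assms by simp
      ultimately have "concat ?L ! ((i * n + (m + j)) mod (n * ?F)) = y ! (m + j - n)"
        unfolding y_def by (simp only: nth)
      \<comment> \<open>As \<open>m\<close> is at most \<open>n - 1\<close> and \<open>j\<close> at
        most \<open>n - 2\<close>, the index \<open>m + j - n\<close> is at most
        \<open>n - 3\<close>, where both rotations agree.\<close>
      also have "\<dots> = x ! Suc (m + j - n)"
        using j False assms by (intro y) simp
      also have "\<dots> = window m x ! j"
        using False j lx assms by (auto simp: window_def nth_append nth_tl add.commute)
      finally show ?thesis
        using * by simp
    qed
  qed
  moreover have "length (window m x) = n - 1"
    using lx assms by (auto simp: window_def)
  ultimately show ?thesis
    by (intro nth_equalityI) (simp_all add: circ_substring_def x_def)
qed

text \<open>A window omits exactly one symbol of its permutation. Conversely, a given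
  \<open>w\<close> misses exactly one symbol \<open>c\<close> of \<open>{1..n}\<close>; inserting
  \<open>c\<close> and undoing the rearrangement recovers a permutation with window
  \<open>w\<close>.\<close>

lemma window_image_perms:
  assumes "m < n"
  shows "window m ` perms n = k_perms (n - 1) n"
proof
  have "window m x \<in> k_perms (n - 1) n" if "x \<in> perms n" for x
  proof -
    have x: "distinct x" "set x = {1..n}" "length x = n"
      using that length_perms by (auto simp: perms_def)
    show ?thesis
    proof (cases "m = 0")
      case True
      then show ?thesis
        using x by (auto simp: window_def k_perms_def distinct_butlast dest: in_set_butlastD)
    next
      case False
      have "distinct (take m x @ drop m x)"
        using x(1) by simp
      then have "set (take m x) \<inter> set (drop m x) = {}"
        unfolding distinct_append by simp
      moreover have tl: "take (m - 1) (tl x) = tl (take m x)"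
        by (simp add: tl_take)
      moreover have "set (tl (take m x)) \<subseteq> set (take m x)"
        by (cases "take m x") auto
      ultimately have "distinct (window m x)"
        using False x(1) by (auto simp: window_def distinct_tl)
      moreover have "set (window m x) \<subseteq> {1..n}"
        using False \<open>set (tl (take m x)) \<subseteq> set (take m x)\<close>
          set_take_subset[of m x] set_drop_subset[of m x]
        unfolding x(2)[symmetric] window_def tl by auto
      moreover have "length (window m x) = n - 1"
        using x(3) False assms by (simp add: window_def)
      ultimately show ?thesis
        by (simp add: k_perms_def)
    qed
  qed
  then show "window m ` perms n \<subseteq> k_perms (n - 1) n"
    by auto
next
  show "k_perms (n - 1) n \<subseteq> window m ` perms n"
  proof
    fix w assume "w \<in> k_perms (n - 1) n"
    then have w: "length w = n - 1" "distinct w" "set w \<subseteq> {1..n}"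
      by (auto simp: k_perms_def)
    have "card ({1..n} - set w) = 1"
      using w assms by (simp add: card_Diff_subset distinct_card)
    then obtain c where c: "{1..n} - set w = {c}"
      by (auto simp: card_1_singleton_iff)
    then have cw: "c \<notin> set w" "insert c (set w) = {1..n}"
      using w(3) by auto
    \<comment> \<open>For \<open>m > 0\<close> the window consists of the final \<open>n - m\<close>
      symbols of \<open>x\<close> followed by those at indices 1 to \<open>m - 1\<close>. Hence
      \<open>w\<close> is cut after \<open>n - m\<close> symbols, the two pieces are exchanged, and
      \<open>c\<close> becomes the head.\<close>
    define x where "x = (if m = 0 then w @ [c] else c # drop (n - m) w @ take (n - m) w)"
    have "distinct (take (n - m) w @ drop (n - m) w)"
      using w(2) by simp
    then have "distinct (drop (n - m) w @ take (n - m) w)"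
      unfolding distinct_append by auto
    moreover have "set (take (n - m) w) \<union> set (drop (n - m) w) = set w"
      by (metis append_take_drop_id set_append)
    ultimately have "x \<in> perms n"
      using cw w(2) by (auto simp: x_def perms_def)
    moreover have "window m x = w"
      using w(1) assms by (auto simp: x_def window_def drop_Cons')
    ultimately show "w \<in> window m ` perms n"
      by blast
  qed
qed

text \<open>The indices start at 1, so residue 0 is supplied by the last index
  \<open>k\<close>.\<close>

lemma mod_image_atLeastAtMost: "(\<lambda>i. i mod k) ` {1..k} = {..<k}" if "k > 0" for k :: nat
proof -
  have "{1..k} = insert k {1..<k}"
    using that by auto
  moreover have "(\<lambda>i. i mod k) ` {1..<k} = id ` {1..<k}"
    by (intro image_cong) auto
  moreover have "insert 0 {1..<k} = {..<k}"
    using that by auto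
  ultimately show ?thesis
    by simp
qed

theorem theorem2:
  fixes n :: nat
  assumes "n \<ge> 2"
  shows "multiversal_cycle n (flattening n)"
proof -
  have "length (flattening n) = n * fact n"
    using assms length_concat_const[of "perm_list n" n]
    by (simp add: flattening_def set_perm_list length_perms length_perm_list)
  moreover have "{circ_substring (flattening n) (m + i * n) (n - 1) | i. i \<in> {1..fact n}} =
      k_perms (n - 1) n" if "m \<in> {0..n - 1}" for m
  proof -
    have m: "m < n"
      using that assms by auto
    have set: "set (perm_list n) = (!) (perm_list n) ` {..<fact n}"
      using assms by (auto simp: set_conv_nth length_perm_list)
    \<comment> \<open>The window depends on \<open>i\<close> only through its residue modulo
      \<open>fact n\<close>, so the set is an image in three stages: residues, entries of the list,
      windows.\<close>
    have "{circ_substring (flattening n) (m + i * n) (n - 1) | i. i \<in> {1..fact n}} =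
        window m ` (!) (perm_list n) ` (\<lambda>i. i mod fact n) ` {1..fact n}"
      using circ_substring_flattening[OF assms m] by auto
    also have "\<dots> = window m ` set (perm_list n)"
      unfolding set by (subst mod_image_atLeastAtMost) simp_all
    also have "\<dots> = k_perms (n - 1) n"
      using assms m by (simp add: set_perm_list window_image_perms)
    finally show ?thesis .
  qed
  ultimately show ?thesis
    by (simp add: multiversal_cycle_def)
qed

end
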